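(* Let $\mathsf{A}\in\mathbb{R}^{J_1\times J_1\times\cdots\times J_N\times J_N}$, let $\Pi_{\mathcal{J}}=\prod_{n=1}^NJ_n$, and let $\lambda_1,\dots,\lambda_{\Pi_{\mathcal{J}}}$ be the U-eigenvalues of $\mathsf{A}$ (with algebraic multiplicity). For the unforced multilinear time-invariant system $\mathsf{X}_{t+1}=\mathsf{A}*\mathsf{X}_t$, $\mathsf{X}_t\in\mathbb{R}^{J_1\times\cdots\times J_N}$, the equilibrium point $\mathsf{X}=\mathsf{O}$ is: 1. stable if and only if $|\lambda_j|\le1$ for all $j=1,\dots,\Pi_{\mathcal{J}}$ and every U-eigenvalue with $|\lambda_j|=1$ has equal algebraic and geometric multiplicities; 2. asymptotically stable if $|\lambda_j|<1$ for all $j=1,\dots,\Pi_{\mathcal{J}}$; 3. unstable if $|\lambda_j|>1$ for some $j\in\{1,\dots,\Pi_{\mathcal{J}}\}$.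
   Context: The Einstein product is $(\mathsf{A}*\mathsf{X})_{j_1\cdots j_N}=\sum_{i_1}\cdots\sum_{i_N}\mathsf{A}_{j_1i_1\cdots j_Ni_N}\mathsf{X}_{i_1\cdots i_N}$. A scalar $\lambda\in\mathbb{C}$ is a U-eigenvalue of $\mathsf{A}$ if $\mathsf{A}*\mathsf{X}=\lambda\mathsf{X}$ for some nonzero $\mathsf{X}\in\mathbb{C}^{J_1\times\cdots\times J_N}$ (a U-eigentensor); algebraic and geometric multiplicities are defined as for matrices, i.e. as those of the linear operator $\mathsf{X}\mapsto\mathsf{A}*\mathsf{X}$ on $\mathbb{C}^{J_1\times\cdots\times J_N}$ (equivalently of the $\Pi_{\mathcal{J}}\times\Pi_{\mathcal{J}}$ unfolding matrix with rows indexed by $(j_1,\dots,j_N)$ and columns by $(i_1,\dots,i_N)$). $\|\cdot\|$ is the Frobenius norm and $\mathsf{O}$ the zero tensor. The equilibrium $\mathsf{X}=\mathsf{O}$ is stable if there is $\gamma>0$ with $\|\mathsf{X}_t\|\le\gamma\|\mathsf{X}_0\|$ for all $t\ge 0$ and all initial conditions $\mathsf{X}_0$; asymptotically stable if $\|\mathsf{X}_t\|\to0$ as $t\to\infty$ for every $\mathsf{X}_0$; unstable if it is not stable. *)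

theory Defs
  imports Complex_Main "HOL-Library.Function_Algebras" "Jordan_Normal_Form.Char_Poly"
begin

text \<open>Tensors of size J are functions on multi-indices (lists of numbers, the n-th entry ranging
  over 0, ..., J ! n - 1) that are zero off the index set, so that equality of tensors is
  equality of functions and the zero tensor is the constant function 0.\<close>

definition tensor_indices :: "nat list \<Rightarrow> nat list set" where
  "tensor_indices J = {js. length js = length J \<and> (\<forall>n < length J. js ! n < J ! n)}"

definition tensors :: "nat list \<Rightarrow> (nat list \<Rightarrow> 'a::zero) set" where
  "tensors J = {X. \<forall>js. js \<notin> tensor_indices J \<longrightarrow> X js = 0}"

text \<open>An even-order paired tensor of size J1 x J1 x ... x JN x JN is an element of
  \<^term>\<open>tensors (splice J J)\<close>; its entry at (j1, i1, ..., jN, iN) is \<^term>\<open>A (splice js ks)\<close>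
  with js = [j1, ..., jN] and ks = [i1, ..., iN].\<close>

definition einstein_product ::
    "nat list \<Rightarrow> (nat list \<Rightarrow> 'a::comm_semiring_0) \<Rightarrow> (nat list \<Rightarrow> 'a) \<Rightarrow> (nat list \<Rightarrow> 'a)" where
  "einstein_product J A X = (\<lambda>js. if js \<in> tensor_indices J
     then \<Sum>ks \<in> tensor_indices J. A (splice js ks) * X ks else 0)"

definition frobenius_norm :: "nat list \<Rightarrow> (nat list \<Rightarrow> real) \<Rightarrow> real" where
  "frobenius_norm J X = sqrt (\<Sum>js \<in> tensor_indices J. (X js)\<^sup>2)"


definition U_eigentensor ::
    "nat list \<Rightarrow> (nat list \<Rightarrow> complex) \<Rightarrow> (nat list \<Rightarrow> complex) \<Rightarrow> complex \<Rightarrow> bool" where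
  "U_eigentensor J A X \<mu> \<longleftrightarrow>
     X \<in> tensors J \<and> X \<noteq> (\<lambda>_. 0) \<and> einstein_product J A X = (\<lambda>js. \<mu> * X js)"

definition U_eigenvalue :: "nat list \<Rightarrow> (nat list \<Rightarrow> complex) \<Rightarrow> complex \<Rightarrow> bool" where
  "U_eigenvalue J A \<mu> \<longleftrightarrow> (\<exists>X. U_eigentensor J A X \<mu>)"

text \<open>The multi-index at linear position r, with the first index running fastest.\<close>

fun multi_index :: "nat list \<Rightarrow> nat \<Rightarrow> nat list" where
  "multi_index [] r = []"
| "multi_index (d # J) r = (r mod d) # multi_index J (r div d)"

lemma multi_index_bij:
  "bij_betw (multi_index J) {..<prod_list J} (tensor_indices J)"
proof (induction J)
  case Nil
  show ?case
    by (auto simp: bij_betw_def tensor_indices_def inj_on_def)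
next
  case (Cons d J)
  let ?f = "\<lambda>(a, ks). a # ks :: nat list"
  have split: "bij_betw (\<lambda>r. (r mod d, r div d)) {..<d * prod_list J} ({..<d} \<times> {..<prod_list J})"
  proof (rule bij_betw_byWitness[where f' = "\<lambda>(a, q). a + d * q"])
    have "a + d * q < d * prod_list J" if "a < d" "q < prod_list J" for a q
    proof -
      have "a + d * q < d * Suc q" using that by simp
      also have "\<dots> \<le> d * prod_list J" using that by (intro mult_left_mono) auto
      finally show ?thesis .
    qed
    then show "(\<lambda>(a, q). a + d * q) ` ({..<d} \<times> {..<prod_list J}) \<subseteq> {..<d * prod_list J}"
      by auto
    have "d > 0 \<and> r div d < prod_list J" if "r < d * prod_list J" for r
      using that by (cases "d = 0") (auto simp: less_mult_imp_div_less mult.commute)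
    then show "(\<lambda>r. (r mod d, r div d)) ` {..<d * prod_list J} \<subseteq> {..<d} \<times> {..<prod_list J}"
      by auto
  qed auto
  have "bij_betw (map_prod id (multi_index J)) ({..<d} \<times> {..<prod_list J})
          ({..<d} \<times> tensor_indices J)"
    using Cons.IH by (intro bij_betw_map_prod) auto
  moreover have "bij_betw ?f ({..<d} \<times> tensor_indices J) (tensor_indices (d # J))"
    unfolding bij_betw_def
  proof
    show "?f ` ({..<d} \<times> tensor_indices J) = tensor_indices (d # J)"
      by (force simp: tensor_indices_def length_Suc_conv nth_Cons split: nat.splits)
  qed (auto simp: inj_on_def)
  ultimately have "bij_betw (?f \<circ> (map_prod id (multi_index J) \<circ> (\<lambda>r. (r mod d, r div d))))
      {..<d * prod_list J} (tensor_indices (d # J))"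
    using split by (blast intro: bij_betw_trans)
  moreover have "?f \<circ> (map_prod id (multi_index J) \<circ> (\<lambda>r. (r mod d, r div d))) = multi_index (d # J)"
    by (auto simp: fun_eq_iff)
  ultimately have "bij_betw (multi_index (d # J)) {..<d * prod_list J} (tensor_indices (d # J))"
    by (simp only:)
  then show ?case by (simp del: multi_index.simps)
qed

definition unfolding_matrix :: "nat list \<Rightarrow> (nat list \<Rightarrow> 'a) \<Rightarrow> 'a mat" where
  "unfolding_matrix J A = mat (prod_list J) (prod_list J)
     (\<lambda>(r, c). A (splice (multi_index J r) (multi_index J c)))"

definition algebraic_multiplicity :: "nat list \<Rightarrow> (nat list \<Rightarrow> complex) \<Rightarrow> complex \<Rightarrow> nat" where
  "algebraic_multiplicity J A \<mu> = order \<mu> (char_poly (unfolding_matrix J A))"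

definition tensor_scale :: "complex \<Rightarrow> (nat list \<Rightarrow> complex) \<Rightarrow> (nat list \<Rightarrow> complex)" where
  "tensor_scale c X = (\<lambda>js. c * X js)"

interpretation tensor_space: vector_space tensor_scale
  by standard (auto simp: tensor_scale_def fun_eq_iff algebra_simps)

definition geometric_multiplicity :: "nat list \<Rightarrow> (nat list \<Rightarrow> complex) \<Rightarrow> complex \<Rightarrow> nat" where
  "geometric_multiplicity J A \<mu> =
     tensor_space.dim {X \<in> tensors J. einstein_product J A X = tensor_scale \<mu> X}"

text \<open>The numbers lam 1, ..., lam P, with P the product of the J's, are the U-eigenvalues of A,
  each one listed as often as its algebraic multiplicity says.\<close>

definition U_eigenvalues_listed :: "nat list \<Rightarrow> (nat list \<Rightarrow> complex) \<Rightarrow> (nat \<Rightarrow> complex) \<Rightarrow> bool" where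
  "U_eigenvalues_listed J A lam \<longleftrightarrow>
     lam ` {1..prod_list J} = {\<mu>. U_eigenvalue J A \<mu>} \<and>
     (\<forall>\<mu>. U_eigenvalue J A \<mu> \<longrightarrow>
        card {j \<in> {1..prod_list J}. lam j = \<mu>} = algebraic_multiplicity J A \<mu>)"


definition MLTI_trajectory ::
    "nat list \<Rightarrow> (nat list \<Rightarrow> real) \<Rightarrow> (nat \<Rightarrow> nat list \<Rightarrow> real) \<Rightarrow> bool" where
  "MLTI_trajectory J A X \<longleftrightarrow>
     (\<forall>t. X t \<in> tensors J) \<and> (\<forall>t. X (Suc t) = einstein_product J A (X t))"

definition MLTI_stable :: "nat list \<Rightarrow> (nat list \<Rightarrow> real) \<Rightarrow> bool" where
  "MLTI_stable J A \<longleftrightarrow> (\<exists>\<gamma>>0. \<forall>X. MLTI_trajectory J A X \<longrightarrow>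
     (\<forall>t. frobenius_norm J (X t) \<le> \<gamma> * frobenius_norm J (X 0)))"

definition MLTI_asymptotically_stable :: "nat list \<Rightarrow> (nat list \<Rightarrow> real) \<Rightarrow> bool" where
  "MLTI_asymptotically_stable J A \<longleftrightarrow> (\<forall>X. MLTI_trajectory J A X \<longrightarrow>
     (\<lambda>t. frobenius_norm J (X t)) \<longlonglongrightarrow> 0)"

definition MLTI_unstable :: "nat list \<Rightarrow> (nat list \<Rightarrow> real) \<Rightarrow> bool" where
  "MLTI_unstable J A \<longleftrightarrow> \<not> MLTI_stable J A"

end

theory Submission
  imports Defs "HOL-Analysis.L2_Norm" "Jordan_Normal_Form.Spectral_Radius"
    "Jordan_Normal_Form.Jordan_Normal_Form_Uniqueness"
begin

text \<open>Unfolding turns tensors into vectors and the Einstein product into multiplication by the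
  unfolding matrix \<open>M\<close>. Stability then means that the powers of \<open>M\<close> are bounded: the columns of
  \<open>M\<^sup>t\<close> are the states at time \<open>t\<close> of the trajectories that start in the unit tensors. For a Jordan
  normal form of \<open>M\<close>, the powers of a block are bounded iff its eigenvalue has modulus below 1, or
  modulus 1 and the block has size 1. All blocks of an eigenvalue have size 1 iff the sum of their
  sizes (the algebraic multiplicity) is their number (the geometric multiplicity). If all
  eigenvalues have modulus below \<open>r < 1\<close>, the criterion applied to \<open>M / r\<close> gives geometric decay.\<close>

section \<open>Bounded powers of complex matrices\<close>

lemma norm_bound_four_block_matD:
  assumes "norm_bound (four_block_mat A B C D) b"
  shows "norm_bound A b" "norm_bound D b"
proof -
  let ?M = "four_block_mat A B C D"
  have M: "norm (?M $$ (i, j)) \<le> b"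
    if "i < dim_row A + dim_row D" "j < dim_col A + dim_col D" for i j
    using assms that unfolding norm_bound_def by simp
  show "norm_bound A b"
  proof
    fix i j assume "i < dim_row A" "j < dim_col A"
    then show "norm (A $$ (i, j)) \<le> b" using M[of i j] by simp
  qed
  show "norm_bound D b"
  proof
    fix i j assume "i < dim_row D" "j < dim_col D"
    then show "norm (D $$ (i, j)) \<le> b" using M[of "dim_row A + i" "dim_col A + j"] by simp
  qed
qed

lemma norm_bound_diag_block_matD:
  assumes "norm_bound (diag_block_mat As) b" "A \<in> set As"
  shows "norm_bound A b"
  using assms
proof (induction As)
  case (Cons B As)
  have "norm_bound B b" "norm_bound (diag_block_mat As) b"
    using norm_bound_four_block_matD[OF Cons.prems(1)[unfolded diag_block_mat.simps Let_def]] .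
  then show ?case using Cons.IH Cons.prems(2) by auto
qed simp

text \<open>Two entries of the first row of the k-th power decide: entry (0, 0) is
  \<open>a ^ k\<close>, which forces modulus at most 1. In a block of size above 1, entry (0, 1) is
  \<open>k * a ^ (k - 1)\<close>, of norm k when \<open>norm a = 1\<close>, hence unbounded.\<close>

lemma jordan_block_power_boundedD:
  fixes a :: "'a :: real_normed_field"
  assumes bound: "\<And>k. norm_bound (jordan_block n a ^\<^sub>m k) c" and "n > 0"
  shows "norm a \<le> 1" "norm a = 1 \<Longrightarrow> n = 1"
proof -
  have entry: "norm ((jordan_block n a ^\<^sub>m k) $$ (0, j)) \<le> c" if "j < n" for j k
    using bound[of k] that unfolding norm_bound_def by auto
  have "norm a ^ k \<le> c" for k
    using entry[of 0 k] \<open>n > 0\<close> by (simp add: jordan_block_pow norm_power)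
  then show "norm a \<le> 1"
    using real_arch_pow[of "norm a" c] by (meson not_le)
  show "n = 1" if "norm a = 1"
  proof (rule ccontr)
    assume "n \<noteq> 1"
    with \<open>n > 0\<close> have "n > 1" by simp
    then have "real k \<le> c" for k
      using entry[of 1 k] that by (simp add: jordan_block_pow norm_mult norm_power)
    then show False by (meson not_le reals_Archimedean2)
  qed
qed

lemma jordan_nf_power_boundedD:
  fixes M :: "'a :: real_normed_field mat"
  assumes M: "M \<in> carrier_mat n n" and jnf: "jordan_nf M n_as"
    and bound: "\<And>k. norm_bound (M ^\<^sub>m k) c" and mem: "(m, a) \<in> set n_as"
  shows "norm a \<le> 1" "norm a = 1 \<Longrightarrow> m = 1"
proof -
  let ?J = "jordan_matrix n_as"
  from jnf obtain P Q where wit: "similar_mat_wit M ?J P Q"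
    unfolding jordan_nf_def similar_mat_def by auto
  note PQ = similar_mat_witD2(6,7)[OF M wit]
  obtain bP where bP: "norm_bound P bP" using norm_bound_max by blast
  obtain bQ where bQ: "norm_bound Q bQ" using norm_bound_max by blast
  \<comment> \<open>The powers of the Jordan matrix are \<open>Q * M ^\<^sub>m k * P\<close>. Each
    of the two products multiplies the entry bounds and adds a factor n for the length of the inner
    sums, so \<open>d\<close> does not depend on k.\<close>
  define d where "d = bQ * c * real n * bP * real n"
  have "norm_bound (jordan_block m a ^\<^sub>m k) d" for k
  proof -
    have Mk: "M ^\<^sub>m k \<in> carrier_mat n n" using M by simp
    have "norm_bound (?J ^\<^sub>m k) d"
      unfolding similar_mat_wit_pow_id[OF similar_mat_wit_sym[OF wit]] d_def
      using norm_bound_mult[OF mult_carrier_mat[OF PQ(2) Mk] PQ(1)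
          norm_bound_mult[OF PQ(2) Mk bQ bound] bP] .
    then show ?thesis
      unfolding jordan_matrix_pow by (rule norm_bound_diag_block_matD) (use mem in force)
  qed
  moreover have "m > 0" using jnf mem unfolding jordan_nf_def by force
  ultimately show "norm a \<le> 1" "norm a = 1 \<Longrightarrow> m = 1"
    by (rule jordan_block_power_boundedD)+
qed

text \<open>The left side is the sum of the sizes of the blocks of \<open>a\<close>, the right side
  counts each such block once, as \<open>min 1\<close> of its size. Sizes are positive, so the sums
  agree only if they agree block by block.\<close>

lemma jordan_nf_semisimple_iff:
  fixes M :: "'a :: field mat"
  assumes jnf: "jordan_nf M n_as"
  shows "Polynomial.order a (char_poly M) = dim_gen_eigenspace M a 1 \<longleftrightarrow> (\<forall>m. (m, a) \<in> set n_as \<longrightarrow> m = 1)"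
proof -
  have "0 \<notin> fst ` set n_as" using jnf unfolding jordan_nf_def by simp
  \<comment> \<open>The inequality strengthens the induction: a surplus from one block cannot be
    cancelled by the remaining ones.\<close>
  then have "sum_list (map (min 1) (map fst [(n, e)\<leftarrow>n_as . e = a])) \<le>
        sum_list (map fst (filter (\<lambda>na. snd na = a) n_as)) \<and>
      (sum_list (map fst (filter (\<lambda>na. snd na = a) n_as)) =
        sum_list (map (min 1) (map fst [(n, e)\<leftarrow>n_as . e = a])) \<longleftrightarrow>
       (\<forall>m. (m, a) \<in> set n_as \<longrightarrow> m = 1))"
    by (induction n_as) (auto simp: min_def)
  then show ?thesis
    unfolding jordan_nf_order[OF jnf] dim_gen_eigenspace[OF jnf] by simp
qed

lemma jordan_nf_eigenvalue_iff:
  fixes M :: "'a :: field mat"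
  assumes M: "M \<in> carrier_mat n n" and jnf: "jordan_nf M n_as"
  shows "eigenvalue M a \<longleftrightarrow> (\<exists>m. (m, a) \<in> set n_as)"
proof -
  have "0 \<notin> fst ` set n_as" using jnf unfolding jordan_nf_def by simp
  then show ?thesis
    unfolding eigenvalue_root_char_poly[OF M] jordan_nf_char_poly[OF jnf]
    by (induction n_as) auto
qed

lemma power_bounded_iff:
  fixes M :: "complex mat"
  assumes M: "M \<in> carrier_mat n n"
  shows "(\<exists>c. \<forall>k. norm_bound (M ^\<^sub>m k) c) \<longleftrightarrow>
    (\<forall>a. eigenvalue M a \<longrightarrow> cmod a \<le> 1 \<and>
      (cmod a = 1 \<longrightarrow> Polynomial.order a (char_poly M) = dim_gen_eigenspace M a 1))"
proof -
  obtain n_as where jnf: "jordan_nf M n_as"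
    using char_poly_factorized[OF M] jordan_nf_exists[OF M] by blast
  have "\<exists>c. \<forall>k. norm_bound (M ^\<^sub>m k) c"
    if "\<forall>m a. (m, a) \<in> set n_as \<longrightarrow> cmod a \<le> 1 \<and> (cmod a = 1 \<longrightarrow> m = 1)"
  proof -
    \<comment> \<open>The exponent is one less than the largest block size allowed on the unit
      circle. That size is 1 here, so the polynomial bound is the constant
      \<open>c1 + c2\<close>.\<close>
    have "\<exists>c1 c2. \<forall>k. norm_bound (M ^\<^sub>m k) (c1 + c2 * of_nat k ^ (1 - 1))"
      by (rule jordan_nf_matrix_poly_bound[OF M _ _ jnf]) (use that in auto)
    then show ?thesis by auto
  qed
  then have "(\<exists>c. \<forall>k. norm_bound (M ^\<^sub>m k) c) \<longleftrightarrow>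
      (\<forall>m a. (m, a) \<in> set n_as \<longrightarrow> cmod a \<le> 1 \<and> (cmod a = 1 \<longrightarrow> m = 1))"
    using jordan_nf_power_boundedD[OF M jnf] by blast
  also have "\<dots> \<longleftrightarrow> (\<forall>a. eigenvalue M a \<longrightarrow> cmod a \<le> 1 \<and>
      (cmod a = 1 \<longrightarrow> Polynomial.order a (char_poly M) = dim_gen_eigenspace M a 1))"
    unfolding jordan_nf_eigenvalue_iff[OF M jnf] jordan_nf_semisimple_iff[OF jnf] by blast
  finally show ?thesis .
qed

section \<open>Powers of scaled matrices and geometric decay\<close>

text \<open>Matrix powers recurse by a factor on the right, whereas a step of the system multiplies
  the state from the left.\<close>

lemma pow_mat_Suc_left:
  fixes M :: "'a :: semiring_1 mat"
  assumes M: "M \<in> carrier_mat n n"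
  shows "M ^\<^sub>m Suc k = M * M ^\<^sub>m k"
proof (induction k)
  case (Suc k)
  have "M ^\<^sub>m Suc (Suc k) = M * M ^\<^sub>m k * M" using Suc by simp
  also have "\<dots> = M * M ^\<^sub>m Suc k" using M by (simp add: assoc_mult_mat[of _ n n _ n _ n])
  finally show ?case .
qed (use M in simp)

lemma smult_pow_mat:
  fixes M :: "'a :: comm_semiring_1 mat"
  assumes M: "M \<in> carrier_mat n n"
  shows "(c \<cdot>\<^sub>m M) ^\<^sub>m k = c ^ k \<cdot>\<^sub>m M ^\<^sub>m k"
proof (induction k)
  case 0
  show ?case by (intro eq_matI) auto
next
  case (Suc k)
  have Mk: "M ^\<^sub>m k \<in> carrier_mat n n" using M by simp
  have "(c \<cdot>\<^sub>m M) ^\<^sub>m Suc k = (c ^ k \<cdot>\<^sub>m M ^\<^sub>m k) * (c \<cdot>\<^sub>m M)" using Suc by simp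
  also have "\<dots> = c ^ k \<cdot>\<^sub>m (c \<cdot>\<^sub>m (M ^\<^sub>m k * M))"
    using mult_smult_assoc_mat[OF Mk smult_carrier_mat[OF M]] mult_smult_distrib[OF Mk M] by simp
  also have "\<dots> = c ^ Suc k \<cdot>\<^sub>m M ^\<^sub>m Suc k"
    using Mk M by (intro eq_matI) (auto simp: mult.assoc mult.commute mult.left_commute)
  finally show ?case .
qed

lemma geometric_norm_bound:
  fixes M :: "complex mat"
  assumes M: "M \<in> carrier_mat n n" and ev: "\<And>a. eigenvalue M a \<Longrightarrow> cmod a < 1"
  obtains c r where "0 < r" "r < 1" "\<And>k. norm_bound (M ^\<^sub>m k) (c * r ^ k)"
proof -
  \<comment> \<open>The added 0 keeps \<open>S\<close> nonempty even for an empty spectrum (n = 0)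
    and makes the maximum nonnegative. Hence the midpoint \<open>r\<close> between that maximum and
    1 is positive and can be divided by.\<close>
  define S where "S = insert 0 (cmod ` spectrum M)"
  define r where "r = (1 + Max S) / 2"
  have fin: "finite S" using card_finite_spectrum(1)[OF M] unfolding S_def by simp
  have "Max S \<in> S" using fin by (intro Max_in) (auto simp: S_def)
  then have "Max S < 1" using ev by (auto simp: S_def spectrum_def)
  moreover have "0 \<le> Max S" using fin by (auto simp: S_def)
  ultimately have r: "0 < r" "r < 1" "Max S < r" by (auto simp: r_def)
  define N where "N = complex_of_real (1 / r) \<cdot>\<^sub>m M"
  have N: "N \<in> carrier_mat n n" using M by (simp add: N_def)
  have "cmod b < 1" if "eigenvalue N b" for b
  proof -
    from that obtain v where v: "v \<in> carrier_vec n" "v \<noteq> 0\<^sub>v n" "N *\<^sub>v v = b \<cdot>\<^sub>v v"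
      using N unfolding eigenvalue_def eigenvector_def by auto
    \<comment> \<open>An eigenvector of \<open>N\<close> for \<open>b\<close> is one of
      \<open>M\<close> for \<open>r * b\<close>, so \<open>r * cmod b\<close> is at most
      \<open>Max S < r\<close>.\<close>
    have "M *\<^sub>v v = complex_of_real r \<cdot>\<^sub>v (N *\<^sub>v v)"
      using r M v(1) by (intro eq_vecI) (auto simp: N_def)
    then have "M *\<^sub>v v = (complex_of_real r * b) \<cdot>\<^sub>v v"
      using v(3) by (simp add: smult_smult_assoc)
    then have "eigenvalue M (complex_of_real r * b)"
      using v M unfolding eigenvalue_def eigenvector_def by auto
    then have "cmod (complex_of_real r * b) \<le> Max S"
      using fin by (intro Max_ge) (auto simp: S_def spectrum_def)
    then have "r * cmod b < r * 1" using r(3) unfolding norm_mult norm_of_real mult_1_right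
      using r(1) by linarith
    then show ?thesis using r(1) by (simp only: mult_less_cancel_left_pos)
  qed
  \<comment> \<open>No eigenvalue of \<open>N\<close> lies on the unit circle, so the multiplicity
    condition of the criterion holds vacuously.\<close>
  then obtain c where c: "\<And>k. norm_bound (N ^\<^sub>m k) c"
    using power_bounded_iff[OF N] by (metis less_eq_real_def less_irrefl)
  have "norm_bound (M ^\<^sub>m k) (c * r ^ k)" for k
  proof
    fix i j assume ij: "i < dim_row (M ^\<^sub>m k)" "j < dim_col (M ^\<^sub>m k)"
    then have "cmod ((N ^\<^sub>m k) $$ (i, j)) \<le> c"
      using c[of k] M N unfolding norm_bound_def by (auto split: if_splits)
    moreover have "N ^\<^sub>m k = complex_of_real (1 / r) ^ k \<cdot>\<^sub>m M ^\<^sub>m k"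
      unfolding N_def by (rule smult_pow_mat[OF M])
    ultimately show "norm ((M ^\<^sub>m k) $$ (i, j)) \<le> c * r ^ k"
      using ij r by (simp add: norm_mult norm_power norm_divide field_simps)
  qed
  with r that show ?thesis by blast
qed

section \<open>Unfolding of tensors\<close>

text \<open>An injective linear map carries a basis of the kernel to a basis of its image. This
  links two notions of dimension: \<open>dim\<close> of a vector space on a whole type, and
  \<open>kernel_dim\<close> of a module with a carrier. Linearity is asked only on the carrier,
  since the vector type contains vectors of every length.\<close>

lemma (in vector_space) dim_image_mat_kernel:
  fixes f :: "'a vec \<Rightarrow> 'b" and K :: "'a mat"
  assumes K: "K \<in> carrier_mat nr nc" and inj: "inj_on f (carrier_vec nc)"
    and add: "\<And>u v. u \<in> carrier_vec nc \<Longrightarrow> v \<in> carrier_vec nc \<Longrightarrow> f (u + v) = f u + f v"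
    and smult: "\<And>c v. v \<in> carrier_vec nc \<Longrightarrow> f (c \<cdot>\<^sub>v v) = scale c (f v)"
  shows "dim (f ` mat_kernel K) = kernel_dim K"
proof -
  interpret K: kernel nr nc K by unfold_locales (rule K)
  have sub: "mat_kernel K \<subseteq> carrier_vec nc" using K.A mat_kernel by auto
  have f0: "f (0\<^sub>v nc) = 0" using smult[of "0\<^sub>v nc" 0] by simp
  have lin: "f (K.NC.lincomb a B) = (\<Sum>b\<in>B. scale (a b) (f b))"
    if "finite B" "B \<subseteq> carrier_vec nc" for a B
    using that
  proof (induction B)
    case empty
    then show ?case by (simp add: K.NC.lincomb_def f0)
  next
    case (insert x B)
    then have "K.NC.lincomb a (insert x B) = a x \<cdot>\<^sub>v x + K.NC.lincomb a B"
      unfolding K.NC.lincomb_def by (subst K.NC.M.finsum_insert) auto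
    moreover have "K.NC.lincomb a B \<in> carrier_vec nc"
      using insert.prems by (intro K.NC.lincomb_closed) auto
    ultimately show ?case using insert add smult by simp
  qed
  obtain B where B: "finite B" "K.basis B" using kernel_basis_exists[OF K] by blast
  then have BK: "B \<subseteq> mat_kernel K" and gen: "K.span B = mat_kernel K" and ind: "K.lin_indpt B"
    unfolding K.Ker.basis_def by auto
  \<comment> \<open>Linear combinations in the kernel coincide with those in the ambient space,
    where \<open>lin\<close> applies.\<close>
  have linB: "f (K.lincomb a B) = (\<Sum>b\<in>B. scale (a b) (f b))" for a
    using lin[of B a] B(1) BK sub K.lincomb_same[OF BK] by auto
  have injB: "inj_on f B" using inj BK sub by (meson inj_on_subset subset_trans)
  have "f ` mat_kernel K = span (f ` B)"
  proof
    show "f ` mat_kernel K \<subseteq> span (f ` B)"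
    proof
      fix y assume "y \<in> f ` mat_kernel K"
      then obtain v where v: "v \<in> K.span B" "y = f v" using gen by blast
      then obtain a where "y = f (K.lincomb a B)"
        using K.Ker.finite_in_span[OF B(1) BK v(1)] by blast
      then show "y \<in> span (f ` B)"
        unfolding linB by (simp add: span_sum span_scale span_base)
    qed
    show "span (f ` B) \<subseteq> f ` mat_kernel K"
    proof
      fix y assume "y \<in> span (f ` B)"
      then obtain u where "y = (\<Sum>v\<in>f ` B. scale (u v) v)"
        using B(1) by (auto simp: span_finite)
      then have "y = f (K.lincomb (u \<circ> f) B)"
        unfolding linB by (simp add: sum.reindex[OF injB])
      moreover have "K.lincomb (u \<circ> f) B \<in> mat_kernel K"
        using BK by (intro K.Ker.lincomb_closed) auto
      ultimately show "y \<in> f ` mat_kernel K" by blast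
    qed
  qed
  moreover have "independent (f ` B)"
  proof (rule independent_if_scalars_zero)
    fix u y assume 0: "(\<Sum>x\<in>f ` B. scale (u x) x) = 0" and y: "y \<in> f ` B"
    have "f (K.lincomb (u \<circ> f) B) = f (0\<^sub>v nc)"
      using 0 unfolding linB f0 by (simp add: sum.reindex[OF injB])
    moreover have "K.lincomb (u \<circ> f) B \<in> carrier_vec nc"
      using BK sub K.Ker.lincomb_closed[of B "u \<circ> f"] by auto
    ultimately have "K.lincomb (u \<circ> f) B = 0\<^sub>v nc"
      using inj by (auto dest: inj_onD)
    then have "(u \<circ> f) \<in> B \<rightarrow> {0}"
      using K.Ker.not_lindepD[OF ind B(1) subset_refl, of "u \<circ> f"] by auto
    then show "u y = 0" using y by auto
  qed (use B(1) in simp)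
  ultimately have "dim (f ` mat_kernel K) = card (f ` B)"
    by (simp add: dim_eq_card)
  also have "\<dots> = kernel_dim K"
    using K.Ker.dim_basis[OF B] by (simp add: card_image[OF injB])
  finally show ?thesis .
qed

section \<open>Mutually inverse passage between tensors and vectors\<close>

definition vectorize :: "nat list \<Rightarrow> (nat list \<Rightarrow> 'a) \<Rightarrow> 'a vec" where
  "vectorize J X = vec (prod_list J) (\<lambda>r. X (multi_index J r))"

definition tensorize :: "nat list \<Rightarrow> 'a::zero vec \<Rightarrow> nat list \<Rightarrow> 'a" where
  "tensorize J v = (\<lambda>js. if js \<in> tensor_indices J
     then v $ inv_into {..<prod_list J} (multi_index J) js else 0)"

lemma multi_index_in: "r < prod_list J \<Longrightarrow> multi_index J r \<in> tensor_indices J"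
  using multi_index_bij[of J] by (auto simp: bij_betw_def)

lemma tensor_indicesE:
  assumes "js \<in> tensor_indices J"
  obtains r where "r < prod_list J" "js = multi_index J r"
  using assms multi_index_bij[of J] by (auto simp: bij_betw_def)

lemma finite_tensor_indices: "finite (tensor_indices J)"
  using bij_betw_finite[OF multi_index_bij[of J]] by simp

lemma sum_tensor_indices: "sum f (tensor_indices J) = (\<Sum>r<prod_list J. f (multi_index J r))"
  using sum.reindex_bij_betw[OF multi_index_bij[of J], of f] by simp

lemma tensor_eqI:
  assumes "X \<in> tensors J" "Y \<in> tensors J" "vectorize J X = vectorize J Y"
  shows "X = Y"
proof
  fix js
  show "X js = Y js"
  proof (cases "js \<in> tensor_indices J")
    case True
    then obtain r where r: "r < prod_list J" "js = multi_index J r" by (rule tensor_indicesE)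
    then show ?thesis using arg_cong[OF assms(3), of "\<lambda>v. v $ r"] by (simp add: vectorize_def)
  qed (use assms in \<open>simp add: tensors_def\<close>)
qed

lemma vectorize_carrier [simp]: "vectorize J X \<in> carrier_vec (prod_list J)"
  by (simp add: vectorize_def)

lemma tensorize_tensors [simp]: "tensorize J v \<in> tensors J"
  by (simp add: tensorize_def tensors_def)

lemma vectorize_tensorize [simp]:
  "v \<in> carrier_vec (prod_list J) \<Longrightarrow> vectorize J (tensorize J v) = v"
  using multi_index_bij[of J]
  by (intro eq_vecI) (auto simp: vectorize_def tensorize_def multi_index_in bij_betw_def)

lemma tensorize_vectorize [simp]: "X \<in> tensors J \<Longrightarrow> tensorize J (vectorize J X) = X"
  by (rule tensor_eqI) auto

lemma einstein_product_tensors: "einstein_product J A X \<in> tensors J"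
  by (simp add: einstein_product_def tensors_def)

lemma unfolding_matrix_carrier [simp]:
  "unfolding_matrix J A \<in> carrier_mat (prod_list J) (prod_list J)"
  by (simp add: unfolding_matrix_def)

lemma unfolding_matrix_dim [simp]:
  "dim_row (unfolding_matrix J A) = prod_list J" "dim_col (unfolding_matrix J A) = prod_list J"
  by (simp_all add: unfolding_matrix_def)

text \<open>Reindexing the sum over multi-indices by linear positions turns it into the scalar
  product with a row of the unfolding matrix.\<close>

lemma vectorize_einstein_product:
  "vectorize J (einstein_product J A X) = unfolding_matrix J A *\<^sub>v vectorize J X"
  by (intro eq_vecI) (auto simp: vectorize_def einstein_product_def unfolding_matrix_def
      multi_index_in sum_tensor_indices scalar_prod_def atLeast0LessThan)

lemma eigentensor_iff_eigenvector:
  assumes "X \<in> tensors J"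
  shows "einstein_product J A X = tensor_scale \<mu> X \<longleftrightarrow>
    unfolding_matrix J A *\<^sub>v vectorize J X = \<mu> \<cdot>\<^sub>v vectorize J X"
proof -
  have "vectorize J (tensor_scale \<mu> X) = \<mu> \<cdot>\<^sub>v vectorize J X"
    by (intro eq_vecI) (auto simp: vectorize_def tensor_scale_def)
  moreover have "tensor_scale \<mu> X \<in> tensors J"
    using assms by (simp add: tensors_def tensor_scale_def)
  ultimately show ?thesis
    using tensor_eqI[OF einstein_product_tensors] vectorize_einstein_product by metis
qed

lemma U_eigenvalue_iff: "U_eigenvalue J A \<mu> \<longleftrightarrow> eigenvalue (unfolding_matrix J A) \<mu>"
proof -
  let ?M = "unfolding_matrix J A"
  have zero: "X = (\<lambda>_. 0) \<longleftrightarrow> vectorize J X = 0\<^sub>v (prod_list J)"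
    if "X \<in> tensors J" for X :: "nat list \<Rightarrow> complex"
  proof -
    have "(\<lambda>_. 0) \<in> tensors J" by (simp add: tensors_def)
    moreover have "vectorize J (\<lambda>_. 0) = 0\<^sub>v (prod_list J)"
      by (intro eq_vecI) (auto simp: vectorize_def)
    ultimately show ?thesis using tensor_eqI[OF that] by metis
  qed
  have "U_eigentensor J A X \<mu> \<longleftrightarrow> X \<in> tensors J \<and> eigenvector ?M (vectorize J X) \<mu>" for X
    using zero[of X] eigentensor_iff_eigenvector[of X J A \<mu>]
    by (auto simp: U_eigentensor_def eigenvector_def tensor_scale_def)
  moreover have "eigenvector ?M v \<mu> \<Longrightarrow> v \<in> carrier_vec (prod_list J)" for v by (simp add: eigenvector_def)
  ultimately show ?thesis
    unfolding U_eigenvalue_def eigenvalue_def by (metis tensorize_tensors vectorize_tensorize)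
qed

lemma geometric_multiplicity_eq:
  "geometric_multiplicity J A \<mu> = dim_gen_eigenspace (unfolding_matrix J A) \<mu> 1"
proof -
  let ?M = "unfolding_matrix J A" and ?P = "prod_list J"
  let ?C = "char_matrix ?M \<mu>"
  have C: "?C \<in> carrier_mat ?P ?P" by simp
  have ker: "v \<in> mat_kernel ?C \<longleftrightarrow> v \<in> carrier_vec ?P \<and> ?M *\<^sub>v v = \<mu> \<cdot>\<^sub>v v" for v
  proof (cases "v \<in> carrier_vec ?P \<and> v \<noteq> 0\<^sub>v ?P")
    case True
    then show ?thesis
      using eigenvector_char_matrix[OF unfolding_matrix_carrier, of J A v \<mu>]
      by (auto simp: mat_kernel[OF C] eigenvector_def)
  next
    case False
    \<comment> \<open>The zero vector is no eigenvector but belongs to both the kernel and the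
      eigenspace, so it is treated apart.\<close>
    have "B *\<^sub>v 0\<^sub>v ?P = 0\<^sub>v ?P" if "B \<in> carrier_mat ?P ?P" for B :: "complex mat"
      using that by (intro eq_vecI) auto
    from False this[OF C] this[of ?M] show ?thesis
      by (auto simp: mat_kernel[OF C])
  qed
  have "{X \<in> tensors J. einstein_product J A X = tensor_scale \<mu> X} = tensorize J ` mat_kernel ?C"
    (is "?E = _")
  proof (intro equalityI subsetI)
    fix X assume "X \<in> ?E"
    then have X: "X \<in> tensors J" "vectorize J X \<in> mat_kernel ?C"
      by (auto simp: ker eigentensor_iff_eigenvector)
    then show "X \<in> tensorize J ` mat_kernel ?C"
      by (intro image_eqI[of _ _ "vectorize J X"]) auto
  qed (auto simp: ker eigentensor_iff_eigenvector)
  moreover have "tensor_space.dim (tensorize J ` mat_kernel ?C) = kernel_dim ?C"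
  proof (rule tensor_space.dim_image_mat_kernel[OF C])
    show "inj_on (tensorize J) (carrier_vec ?P)"
      by (rule inj_on_inverseI[of _ "vectorize J"]) simp
  qed (auto simp: tensorize_def tensor_scale_def fun_eq_iff elim!: tensor_indicesE
      simp: bij_betw_inv_into_left[OF multi_index_bij])
  ultimately show ?thesis
    using C by (simp add: geometric_multiplicity_def dim_gen_eigenspace_def)
qed

lemma unfolding_matrix_of_real_pow:
  "unfolding_matrix J (complex_of_real \<circ> A) ^\<^sub>m k =
    map_mat complex_of_real (unfolding_matrix J A ^\<^sub>m k)"
proof -
  have "unfolding_matrix J (complex_of_real \<circ> A) = map_mat complex_of_real (unfolding_matrix J A)"
    by (intro eq_matI) (auto simp: unfolding_matrix_def)
  then show ?thesis by (simp add: of_real_hom.mat_hom_pow[OF unfolding_matrix_carrier])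
qed

text \<open>The embedding of the reals preserves products and norms. Thus the complex Jordan theory
  decides the boundedness of a real system.\<close>

lemma norm_bound_unfolding_matrix_of_real:
  "norm_bound (unfolding_matrix J (complex_of_real \<circ> A) ^\<^sub>m k) c \<longleftrightarrow>
    norm_bound (unfolding_matrix J A ^\<^sub>m k) c"
  unfolding unfolding_matrix_of_real_pow norm_bound_def by auto

section \<open>Trajectories\<close>

lemma MLTI_trajectory_vectorize:
  assumes "MLTI_trajectory J A X"
  shows "vectorize J (X t) = unfolding_matrix J A ^\<^sub>m t *\<^sub>v vectorize J (X 0)"
proof (induction t)
  case 0
  show ?case by simp
next
  case (Suc t)
  let ?M = "unfolding_matrix J A"
  have "vectorize J (X (Suc t)) = ?M *\<^sub>v (?M ^\<^sub>m t *\<^sub>v vectorize J (X 0))"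
    using assms Suc by (simp add: MLTI_trajectory_def vectorize_einstein_product)
  also have "\<dots> = (?M * ?M ^\<^sub>m t) *\<^sub>v vectorize J (X 0)"
    by (rule assoc_mult_mat_vec[symmetric, of _ "prod_list J" "prod_list J" _ "prod_list J"]) auto
  also have "?M * ?M ^\<^sub>m t = ?M ^\<^sub>m Suc t"
    by (rule pow_mat_Suc_left[OF unfolding_matrix_carrier, symmetric])
  finally show ?case .
qed

lemma MLTI_trajectory_exists:
  assumes "X0 \<in> tensors J"
  obtains X where "MLTI_trajectory J A X" "X 0 = X0"
proof
  let ?X = "\<lambda>t. (einstein_product J A ^^ t) X0"
  show "MLTI_trajectory J A ?X"
    unfolding MLTI_trajectory_def
  proof (intro conjI allI)
    show "?X t \<in> tensors J" for t
      using assms by (cases t) (auto simp: einstein_product_tensors)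
  qed simp
qed simp

lemma frobenius_norm_eq_L2_set: "frobenius_norm J X = L2_set X (tensor_indices J)"
  by (simp add: frobenius_norm_def L2_set_def)

lemma frobenius_norm_nonneg [simp]: "0 \<le> frobenius_norm J X"
  by (simp add: frobenius_norm_eq_L2_set)

lemma abs_le_frobenius_norm:
  assumes "js \<in> tensor_indices J"
  shows "\<bar>X js\<bar> \<le> frobenius_norm J X"
proof -
  have "(X js)\<^sup>2 \<le> (\<Sum>ks\<in>tensor_indices J. (X ks)\<^sup>2)"
    using assms finite_tensor_indices by (intro member_le_sum) auto
  then show ?thesis unfolding frobenius_norm_def by (intro real_le_rsqrt) simp
qed

text \<open>One factor \<open>prod_list J\<close> comes from the sum that forms an entry of the
  state, the other from bounding the Frobenius norm by the sum of the absolute entries.\<close>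

lemma frobenius_norm_le:
  assumes traj: "MLTI_trajectory J A X" and bound: "norm_bound (unfolding_matrix J A ^\<^sub>m t) b"
  shows "frobenius_norm J (X t) \<le> (real (prod_list J))\<^sup>2 * b * frobenius_norm J (X 0)"
proof -
  let ?M = "unfolding_matrix J A" and ?P = "prod_list J" and ?F = "frobenius_norm J (X 0)"
  have Mt: "?M ^\<^sub>m t \<in> carrier_mat ?P ?P" by simp
  have "\<bar>X t (multi_index J r)\<bar> \<le> real ?P * (b * ?F)" if r: "r < ?P" for r
  proof -
    have "X t (multi_index J r) = vectorize J (X t) $ r" using r by (simp add: vectorize_def)
    also have "\<dots> = (\<Sum>s<?P. (?M ^\<^sub>m t) $$ (r, s) * X 0 (multi_index J s))"
      unfolding MLTI_trajectory_vectorize[OF traj, of t] using r Mt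
      by (simp add: scalar_prod_def vectorize_def atLeast0LessThan)
    also have "\<bar>\<dots>\<bar> \<le> (\<Sum>s<?P. b * ?F)"
    proof (rule order_trans[OF sum_abs sum_mono])
      fix s assume "s \<in> {..<?P}"
      then have s: "s < ?P" by simp
      have "\<bar>(?M ^\<^sub>m t) $$ (r, s)\<bar> \<le> b"
        using bound r s Mt unfolding norm_bound_def by auto
      moreover have "\<bar>X 0 (multi_index J s)\<bar> \<le> ?F"
        by (rule abs_le_frobenius_norm[OF multi_index_in[OF s]])
      ultimately show "\<bar>(?M ^\<^sub>m t) $$ (r, s) * X 0 (multi_index J s)\<bar> \<le> b * ?F"
        unfolding abs_mult by (intro mult_mono) auto
    qed
    finally show ?thesis by simp
  qed
  then have "(\<Sum>r<?P. \<bar>X t (multi_index J r)\<bar>) \<le> (\<Sum>r<?P. real ?P * (b * ?F))"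
    by (intro sum_mono) auto
  then have "(\<Sum>js\<in>tensor_indices J. \<bar>X t js\<bar>) \<le> (real ?P)\<^sup>2 * b * ?F"
    by (simp add: sum_tensor_indices power2_eq_square mult.assoc)
  with L2_set_le_sum_abs show ?thesis
    unfolding frobenius_norm_eq_L2_set by (rule order_trans)
qed

lemma MLTI_stable_iff:
  "MLTI_stable J A \<longleftrightarrow> (\<exists>c. \<forall>k. norm_bound (unfolding_matrix J A ^\<^sub>m k) c)"
proof
  let ?M = "unfolding_matrix J A" and ?P = "prod_list J"
  assume "MLTI_stable J A"
  then obtain \<gamma> where \<gamma>: "\<And>X t. MLTI_trajectory J A X \<Longrightarrow>
      frobenius_norm J (X t) \<le> \<gamma> * frobenius_norm J (X 0)"
    unfolding MLTI_stable_def by blast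
  have "norm_bound (?M ^\<^sub>m k) \<gamma>" for k
  proof
    fix i j assume "i < dim_row (?M ^\<^sub>m k)" "j < dim_col (?M ^\<^sub>m k)"
    then have ij: "i < ?P" "j < ?P" by (simp_all split: if_splits)
    have Mk: "?M ^\<^sub>m k \<in> carrier_mat ?P ?P" by simp
    \<comment> \<open>From the j-th unit tensor, of norm 1, the state at time k is column j of the
      k-th power, so \<gamma> itself bounds its entries.\<close>
    obtain X where X: "MLTI_trajectory J A X" "X 0 = tensorize J (unit_vec ?P j)"
      using MLTI_trajectory_exists[OF tensorize_tensors] .
    have "frobenius_norm J (X 0) = 1"
    proof -
      have "(\<Sum>js\<in>tensor_indices J. (X 0 js)\<^sup>2) = (\<Sum>r<?P. (vectorize J (X 0) $ r)\<^sup>2)"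
        by (simp add: sum_tensor_indices vectorize_def)
      also have "\<dots> = (\<Sum>r<?P. if r = j then 1 else 0)"
        unfolding X(2) using ij by (intro sum.cong) auto
      finally show ?thesis using ij by (simp add: frobenius_norm_def)
    qed
    have "(?M ^\<^sub>m k) $$ (i, j) = vectorize J (X k) $ i"
      unfolding MLTI_trajectory_vectorize[OF X(1), of k] X(2) using ij Mk by simp
    also have "\<dots> = X k (multi_index J i)" using ij by (simp add: vectorize_def)
    also have "\<bar>\<dots>\<bar> \<le> frobenius_norm J (X k)"
      by (rule abs_le_frobenius_norm[OF multi_index_in[OF ij(1)]])
    also have "\<dots> \<le> \<gamma>" using \<gamma>[OF X(1), of k] \<open>frobenius_norm J (X 0) = 1\<close> by simp
    finally show "norm ((?M ^\<^sub>m k) $$ (i, j)) \<le> \<gamma>" by simp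
  qed
  then show "\<exists>c. \<forall>k. norm_bound (?M ^\<^sub>m k) c" by blast
next
  let ?M = "unfolding_matrix J A" and ?P = "prod_list J"
  assume "\<exists>c. \<forall>k. norm_bound (?M ^\<^sub>m k) c"
  then obtain c where c: "\<And>k. norm_bound (?M ^\<^sub>m k) c" by blast
  \<comment> \<open>Stability requires a positive constant; the absolute value and the added 1
    ensure this without any sign condition on \<open>c\<close>.\<close>
  let ?\<gamma> = "\<bar>(real ?P)\<^sup>2 * c\<bar> + 1"
  have "frobenius_norm J (X t) \<le> ?\<gamma> * frobenius_norm J (X 0)" if "MLTI_trajectory J A X" for X t
    by (rule order_trans[OF frobenius_norm_le[OF that c]])
      (intro mult_right_mono, auto)
  moreover have "?\<gamma> > 0" by simp
  ultimately show "MLTI_stable J A" unfolding MLTI_stable_def by blast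
qed

lemma MLTI_asymptotically_stableI:
  assumes "0 < r" "r < 1" and bound: "\<And>k. norm_bound (unfolding_matrix J A ^\<^sub>m k) (c * r ^ k)"
  shows "MLTI_asymptotically_stable J A"
  unfolding MLTI_asymptotically_stable_def
proof (intro allI impI)
  fix X assume traj: "MLTI_trajectory J A X"
  let ?b = "\<lambda>t. (real (prod_list J))\<^sup>2 * (c * r ^ t) * frobenius_norm J (X 0)"
  have "?b \<longlonglongrightarrow> (real (prod_list J))\<^sup>2 * (c * 0) * frobenius_norm J (X 0)"
    using assms by (intro tendsto_intros LIMSEQ_realpow_zero) auto
  then have "?b \<longlonglongrightarrow> 0" by simp
  then show "(\<lambda>t. frobenius_norm J (X t)) \<longlonglongrightarrow> 0"
    by (rule tendsto_sandwich[of "\<lambda>_. 0" _ _ ?b, rotated 3])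
      (use frobenius_norm_le[OF traj bound] in auto)
qed

theorem proposition5p1:
  fixes J :: "nat list" and A :: "nat list \<Rightarrow> real" and lam :: "nat \<Rightarrow> complex"
  assumes "J \<noteq> []" and "\<forall>d \<in> set J. d \<ge> 1"
    and "A \<in> tensors (splice J J)"
    and "U_eigenvalues_listed J (complex_of_real \<circ> A) lam"
  shows
    "(MLTI_stable J A \<longleftrightarrow>
        (\<forall>j \<in> {1..prod_list J}. cmod (lam j) \<le> 1) \<and>
        (\<forall>j \<in> {1..prod_list J}. cmod (lam j) = 1 \<longrightarrow>
           algebraic_multiplicity J (complex_of_real \<circ> A) (lam j) =
           geometric_multiplicity J (complex_of_real \<circ> A) (lam j)))
     \<and> ((\<forall>j \<in> {1..prod_list J}. cmod (lam j) < 1) \<longrightarrow> MLTI_asymptotically_stable J A)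
     \<and> ((\<exists>j \<in> {1..prod_list J}. cmod (lam j) > 1) \<longrightarrow> MLTI_unstable J A)"
proof -
  let ?A = "complex_of_real \<circ> A"
  let ?M = "unfolding_matrix J ?A"
  \<comment> \<open>Conditions on all eigenvalues of the unfolding become conditions on the listed
    numbers.\<close>
  have ev: "eigenvalue ?M a \<longleftrightarrow> a \<in> lam ` {1..prod_list J}" for a
    using assms(4) unfolding U_eigenvalues_listed_def U_eigenvalue_iff by auto
  have stable: "MLTI_stable J A \<longleftrightarrow>
      (\<forall>j \<in> {1..prod_list J}. cmod (lam j) \<le> 1) \<and>
      (\<forall>j \<in> {1..prod_list J}. cmod (lam j) = 1 \<longrightarrow>
         algebraic_multiplicity J ?A (lam j) = geometric_multiplicity J ?A (lam j))"
    unfolding MLTI_stable_iff norm_bound_unfolding_matrix_of_real[symmetric]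
      power_bounded_iff[OF unfolding_matrix_carrier] ev
      algebraic_multiplicity_def geometric_multiplicity_eq
    by auto
  moreover have "MLTI_asymptotically_stable J A" if lt: "\<forall>j \<in> {1..prod_list J}. cmod (lam j) < 1"
  proof -
    have "cmod a < 1" if "eigenvalue ?M a" for a
      using that lt unfolding ev by auto
    from geometric_norm_bound[OF unfolding_matrix_carrier this] obtain c r
      where "0 < r" "r < 1" "\<And>k. norm_bound (?M ^\<^sub>m k) (c * r ^ k)" by blast
    then show ?thesis
      unfolding norm_bound_unfolding_matrix_of_real by (rule MLTI_asymptotically_stableI)
  qed
  \<comment> \<open>Such an eigenvalue violates the modulus condition in
    \<open>stable\<close>.\<close>
  moreover have "MLTI_unstable J A" if "\<exists>j \<in> {1..prod_list J}. cmod (lam j) > 1"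
    using that stable unfolding MLTI_unstable_def by force
  ultimately show ?thesis by blast
qed

end
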